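(* Let $((S,d),\phi)$ be a flow of $\mathcal L_{qm}$ such that $d$ is a quasimetric (that is, $d$ takes only finite values), and let $k\in\mathbb N$. Then $\widetilde h(\phi^k)=k\cdot\widetilde h(\phi)$.
   Context: A generalized quasimetric on a non-empty set $S$ is a function $d\colon S\times S\to\mathbb R_{\ge0}\cup\{\infty\}$ with (QM1) $d(x,y)=d(y,x)=0$ if and only if $x=y$, and (QM2) $d(x,z)\le d(x,y)+d(y,z)$ for all $x,y,z$. It induces the partial order $x\le y\iff d(y,x)=0$. The category $\mathcal L_{qm}$ has as objects the pairs $(S,d)$ such that $d$ is a generalized quasimetric, $(S,\le)$ is a join-semilattice (join written $+$) with bottom element $0$, and (QM3) $d(x,y)=d(x,x+y)$ for all $x,y$; its morphisms are the maps $\phi\colon (S,d)\to(S',d')$ with $\phi(x+y)=\phi(x)+\phi(y)$, $\phi(0)=0$ and $d'(\phi(x),\phi(y))\le d(x,y)$ for all $x,y$. A flow of $\mathcal L_{qm}$ is a pair $((S,d),\phi)$ with $(S,d)\in\mathcal L_{qm}$ and $\phi\colon(S,d)\to(S,d)$ an endomorphism in $\mathcal L_{qm}$. For a flow $((S,d),\phi)$ of $\mathcal L_{qm}$, $x\in S$ is $\phi$-inert if $d(x,\phi(x))<\infty$; $\mathcal I_\phi(S)$ is the set of $\phi$-inert elements; $T_n(\phi,x)=x+\phi(x)+\dots+\phi^{n-1}(x)$ for $n\ge1$. For $x\in\mathcal I_\phi(S)$ put $\widetilde h(\phi,x)=\lim_{n\to\infty}\frac{d(x,T_n(\phi,x))}{n}$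 (this limit exists), and $\widetilde h(\phi)=\sup\{\widetilde h(\phi,x)\mid x\in\mathcal I_\phi(S)\}\in\mathbb R_{\ge0}\cup\{\infty\}$. $\mathbb N$ contains $0$; $\phi^0$ is the identity; $0\cdot\infty=0$. *)

theory Defs
  imports "HOL-Library.Extended_Nonnegative_Real" "HOL-Algebra.Lattice"
begin

locale generalized_quasimetric =
  fixes S :: "'a set" and d :: "'a \<Rightarrow> 'a \<Rightarrow> ennreal"
  assumes nonempty: "S \<noteq> {}"
    and QM1: "x \<in> S \<Longrightarrow> y \<in> S \<Longrightarrow> (d x y = 0 \<and> d y x = 0) \<longleftrightarrow> x = y"
    and QM2: "x \<in> S \<Longrightarrow> y \<in> S \<Longrightarrow> z \<in> S \<Longrightarrow> d x z \<le> d x y + d y z"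

locale quasimetric = generalized_quasimetric +
  assumes finite_dist: "x \<in> S \<Longrightarrow> y \<in> S \<Longrightarrow> d x y < \<infinity>"

(* Note the reversed arguments: x is below y iff d y x = 0.  The join x + y is
   join (qm_order S d) x y, and 0 is bottom (qm_order S d). *)
definition qm_order :: "'a set \<Rightarrow> ('a \<Rightarrow> 'a \<Rightarrow> ennreal) \<Rightarrow> 'a gorder" where
  "qm_order S d = \<lparr>carrier = S, eq = (=), le = (\<lambda>x y. d y x = 0)\<rparr>"

locale Lqm = generalized_quasimetric S d
    + upper_semilattice "qm_order S d"
    + weak_partial_order_bottom "qm_order S d"
  for S :: "'a set" and d :: "'a \<Rightarrow> 'a \<Rightarrow> ennreal" +
  assumes QM3: "x \<in> S \<Longrightarrow> y \<in> S \<Longrightarrow> d x y = d x (x \<squnion>\<^bsub>qm_order S d\<^esub> y)"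

definition Lqm_hom ::
  "'a set \<Rightarrow> ('a \<Rightarrow> 'a \<Rightarrow> ennreal) \<Rightarrow> 'b set \<Rightarrow> ('b \<Rightarrow> 'b \<Rightarrow> ennreal) \<Rightarrow> ('a \<Rightarrow> 'b) set" where
  "Lqm_hom S d S' d' = {\<phi>. \<phi> \<in> S \<rightarrow> S'
     \<and> (\<forall>x\<in>S. \<forall>y\<in>S. \<phi> (x \<squnion>\<^bsub>qm_order S d\<^esub> y) = \<phi> x \<squnion>\<^bsub>qm_order S' d'\<^esub> \<phi> y)
     \<and> \<phi> \<bottom>\<^bsub>qm_order S d\<^esub> = \<bottom>\<^bsub>qm_order S' d'\<^esub>
     \<and> (\<forall>x\<in>S. \<forall>y\<in>S. d' (\<phi> x) (\<phi> y) \<le> d x y)}"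

definition Lqm_flow :: "'a set \<Rightarrow> ('a \<Rightarrow> 'a \<Rightarrow> ennreal) \<Rightarrow> ('a \<Rightarrow> 'a) \<Rightarrow> bool" where
  "Lqm_flow S d \<phi> \<longleftrightarrow> Lqm S d \<and> \<phi> \<in> Lqm_hom S d S d"

definition inert_elements :: "'a set \<Rightarrow> ('a \<Rightarrow> 'a \<Rightarrow> ennreal) \<Rightarrow> ('a \<Rightarrow> 'a) \<Rightarrow> 'a set" where
  "inert_elements S d \<phi> = {x \<in> S. d x (\<phi> x) < \<infinity>}"

(* x + \<phi> x + ... + \<phi>^(n-1) x; the empty join 0 at n = 0 is a convention, so that
   the value at n = 1 is 0 + x = x. *)
primrec trajectory ::
  "'a set \<Rightarrow> ('a \<Rightarrow> 'a \<Rightarrow> ennreal) \<Rightarrow> ('a \<Rightarrow> 'a) \<Rightarrow> 'a \<Rightarrow> nat \<Rightarrow> 'a" where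
  "trajectory S d \<phi> x 0 = \<bottom>\<^bsub>qm_order S d\<^esub>"
| "trajectory S d \<phi> x (Suc n) = trajectory S d \<phi> x n \<squnion>\<^bsub>qm_order S d\<^esub> (\<phi> ^^ n) x"

definition qm_entropy_at ::
  "'a set \<Rightarrow> ('a \<Rightarrow> 'a \<Rightarrow> ennreal) \<Rightarrow> ('a \<Rightarrow> 'a) \<Rightarrow> 'a \<Rightarrow> ennreal" where
  "qm_entropy_at S d \<phi> x = lim (\<lambda>n. d x (trajectory S d \<phi> x n) / of_nat n)"

definition qm_entropy :: "'a set \<Rightarrow> ('a \<Rightarrow> 'a \<Rightarrow> ennreal) \<Rightarrow> ('a \<Rightarrow> 'a) \<Rightarrow> ennreal" where
  "qm_entropy S d \<phi> = (SUP x\<in>inert_elements S d \<phi>. qm_entropy_at S d \<phi> x)"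

end

theory Submission
  imports Defs
begin

text \<open>
  Write \<open>T\<^sub>n(x)\<close> for the trajectory of \<open>x\<close> under \<open>\<phi>\<close> and \<open>b\<^sub>n = d x (T\<^sub>n\<^sub>+\<^sub>1(x))\<close>.  The join
  \<open>T\<^sub>n(x)\<close> is the least upper bound of \<open>x, \<phi> x, \<dots>, \<phi>\<^sup>n\<^sup>-\<^sup>1 x\<close>, and this is the only way in
  which trajectories are handled: every comparison of two of them comes from comparing
  the index sets of the points that they join.

  The shift by one in \<open>b\<close> makes the trajectories overlap: \<open>T\<^sub>m\<^sub>+\<^sub>n\<^sub>+\<^sub>1(x)\<close> lies below
  \<open>T\<^sub>m\<^sub>+\<^sub>1(x) + \<phi>\<^sup>m (T\<^sub>n\<^sub>+\<^sub>1(x))\<close>, in which both summands contain \<open>\<phi>\<^sup>m x\<close>.  Since \<open>d\<close> decreases in its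
  first argument and \<open>\<phi>\<^sup>m\<close> does not increase distances, \<open>b\<close> is subadditive, and Fekete's
  lemma gives the limit defining the entropy of \<open>\<phi>\<close> at an inert point.

  For the formula itself, \<open>T\<^sub>n(\<phi>\<^sup>k, x)\<close> joins some of the points of \<open>T\<^sub>k\<^sub>n\<^sub>+\<^sub>1(\<phi>, x)\<close>, whose distance
  from \<open>x\<close>, divided by \<open>n\<close>, tends to \<open>k\<close> times the entropy of \<open>\<phi>\<close> at \<open>x\<close>; so passing to \<open>\<phi>\<^sup>k\<close> multiplies the entropy at \<open>x\<close> by at most \<open>k\<close>.  The opposite estimate needs
  a different base point: starting \<open>\<phi>\<^sup>k\<close> at \<open>y = T\<^sub>k(\<phi>, x)\<close> fills the gaps, for
  \<open>T\<^sub>k\<^sub>n(\<phi>, x) \<le> T\<^sub>n(\<phi>\<^sup>k, y)\<close>, and replacing \<open>x\<close> by \<open>y\<close> costs only the bounded amount \<open>d x y\<close>.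
  Finiteness of \<open>d\<close> makes every point inert for both maps, so that the two suprema
  range over the same set and the two pointwise estimates give equality.
\<close>

section \<open>Subadditive sequences\<close>

lemma divide_of_nat_tendsto_0_ennreal:
  assumes "(c::ennreal) < \<infinity>"
  shows "(\<lambda>n. c / of_nat n) \<longlonglongrightarrow> 0"
proof -
  obtain r where r: "c = ennreal r" "0 \<le> r" using assms by (cases c) auto
  have "(\<lambda>n. ennreal (r / real n)) \<longlonglongrightarrow> ennreal 0"
    by (intro tendsto_ennrealI lim_const_over_n)
  moreover have "\<forall>\<^sub>F n in sequentially. ennreal (r / real n) = c / of_nat n"
    using eventually_ge_at_top[of 1]
    by eventually_elim (simp add: r divide_ennreal ennreal_of_nat_eq_real_of_nat)
  ultimately show ?thesis by (simp add: tendsto_cong)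
qed

text \<open>
  Fekete's lemma.  For fixed \<open>m\<close>, cutting \<open>n\<close> into blocks of length \<open>m\<close> shows that \<open>u n / n\<close> exceeds
  \<open>u m / m\<close> by at most \<open>C / n\<close>, where \<open>C\<close> bounds the contribution of the incomplete block.
\<close>

lemma fekete_ennreal:
  fixes u :: "nat \<Rightarrow> ennreal"
  assumes sub: "\<And>m n. u (m + n) \<le> u m + u n"
    and fin: "\<And>n. u n < \<infinity>"
  shows "(\<lambda>n. u n / of_nat n) \<longlonglongrightarrow> (INF n\<in>{1..}. u n / of_nat n)"
proof (rule order_tendstoI)
  fix a assume a: "a < (INF n\<in>{1..}. u n / of_nat n)"
  show "\<forall>\<^sub>F n in sequentially. a < u n / of_nat n"
    using eventually_ge_at_top[of 1]
  proof eventually_elim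
    case (elim n)
    then show ?case using a by (auto intro: less_le_trans INF_lower)
  qed
next
  fix a assume "(INF n\<in>{1..}. u n / of_nat n) < a"
  then obtain m where m: "1 \<le> m" and um: "u m / of_nat m < a"
    by (auto simp: INF_less_iff)
  define C where "C = (\<Sum>r<m. u r)"
  have C: "C < \<infinity>" using fin by (simp add: C_def less_top)
  have block: "u (q * m + r) \<le> of_nat q * u m + u r" for q r
  proof (induction q)
    case (Suc q)
    have "u (Suc q * m + r) \<le> u m + u (q * m + r)"
      using sub[of m "q * m + r"] by (simp add: add.assoc)
    also have "\<dots> \<le> u m + (of_nat q * u m + u r)"
      using Suc.IH by (rule add_left_mono)
    finally show ?case by (simp add: algebra_simps)
  qed simp
  have bound: "u n / of_nat n \<le> u m / of_nat m + C / of_nat n" if n: "1 \<le> n" for n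
  proof -
    have "u (n mod m) \<le> C"
      unfolding C_def using m by (intro member_le_sum) auto
    then have le: "u n \<le> of_nat (n div m) * u m + C"
      using block[of "n div m" "n mod m"] by (metis add_left_mono div_mult_mod_eq order_trans)
    obtain y where y: "u m = ennreal y" "0 \<le> y" using fin[of m] by (cases "u m") auto
    obtain z where z: "u n = ennreal z" "0 \<le> z" using fin[of n] by (cases "u n") auto
    obtain c where c: "C = ennreal c" "0 \<le> c" using C by (cases C) auto
    have "z \<le> real (n div m) * y + c"
      using le y z c
      by (simp add: ennreal_of_nat_eq_real_of_nat ennreal_mult[symmetric] ennreal_plus[symmetric] del: ennreal_plus)
    also have "\<dots> \<le> (real n / real m) * y + c"
      using y by (intro add_right_mono mult_right_mono of_nat_div_le_of_nat)
    finally have "z / real n \<le> y / real m + c / real n"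
      using n m by (simp add: field_simps)
    then show ?thesis
      using y z c n m
      by (simp add: ennreal_of_nat_eq_real_of_nat divide_ennreal ennreal_plus[symmetric] del: ennreal_plus)
  qed
  have "(\<lambda>n. u m / of_nat m + C / of_nat n) \<longlonglongrightarrow> u m / of_nat m + 0"
    using C by (intro tendsto_add tendsto_const divide_of_nat_tendsto_0_ennreal)
  then have "\<forall>\<^sub>F n in sequentially. u m / of_nat m + C / of_nat n < a"
    using um by (auto dest: order_tendstoD(2))
  then show "\<forall>\<^sub>F n in sequentially. u n / of_nat n < a"
    using eventually_ge_at_top[of 1]
    by eventually_elim (use bound in \<open>auto intro: le_less_trans\<close>)
qed

text \<open>
  Trajectories with \<open>n + 1\<close> points are subadditive in \<open>n\<close>, whereas entropy divides by the number
  of points; the two normalisations have the same limit.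
\<close>

lemma tendsto_divide_of_nat_Suc_ennreal:
  fixes u :: "nat \<Rightarrow> ennreal"
  assumes lim: "(\<lambda>n. u n / of_nat n) \<longlonglongrightarrow> L"
    and fin: "\<And>n. u n < \<infinity>" and "L < \<infinity>"
  shows "(\<lambda>n. u n / of_nat (Suc n)) \<longlonglongrightarrow> L"
proof -
  define r where "r n = enn2real (u n)" for n
  have u: "u n = ennreal (r n)" and r: "0 \<le> r n" for n
    using fin[of n] by (auto simp: r_def)
  obtain l where l: "L = ennreal l" "0 \<le> l" using \<open>L < \<infinity>\<close> by (cases L) auto
  have "\<forall>\<^sub>F n in sequentially. u n / of_nat n = ennreal (r n / real n)"
    using eventually_ge_at_top[of 1]
    by eventually_elim (simp add: u r divide_ennreal ennreal_of_nat_eq_real_of_nat)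
  with lim have "(\<lambda>n. ennreal (r n / real n)) \<longlonglongrightarrow> ennreal l"
    by (simp add: l tendsto_cong)
  then have "(\<lambda>n. r n / real n) \<longlonglongrightarrow> l"
    using r l by (subst (asm) tendsto_ennreal_iff) auto
  then have "(\<lambda>n. r n / real n * (real n / real (Suc n))) \<longlonglongrightarrow> l * 1"
    by (rule tendsto_mult[OF _ LIMSEQ_n_over_Suc_n])
  then have "(\<lambda>n. ennreal (r n / real n * (real n / real (Suc n)))) \<longlonglongrightarrow> L"
    unfolding l by (intro tendsto_ennrealI) simp
  moreover have "\<forall>\<^sub>F n in sequentially.
      ennreal (r n / real n * (real n / real (Suc n))) = u n / of_nat (Suc n)"
    using eventually_ge_at_top[of 1]
    by eventually_elim
      (simp add: u r divide_ennreal ennreal_of_nat_eq_real_of_nat del: of_nat_Suc)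
  ultimately show ?thesis by (simp add: tendsto_cong del: of_nat_Suc)
qed

lemma tendsto_subsequence_divide_of_nat_ennreal:
  fixes u :: "nat \<Rightarrow> ennreal"
  assumes lim: "(\<lambda>n. u n / of_nat n) \<longlonglongrightarrow> L" and k: "0 < k"
  shows "(\<lambda>n. u (k * n) / of_nat n) \<longlonglongrightarrow> of_nat k * L"
proof -
  have "filterlim (\<lambda>n. k * n) sequentially sequentially"
    using k by (rule mult_nat_left_at_top)
  then have "(\<lambda>n. u (k * n) / of_nat (k * n)) \<longlonglongrightarrow> L"
    by (rule filterlim_compose[OF lim])
  then have "(\<lambda>n. of_nat k * (u (k * n) / of_nat (k * n))) \<longlonglongrightarrow> of_nat k * L"
    by (intro ennreal_tendsto_cmult) (auto simp: of_nat_less_top)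
  moreover have "\<forall>\<^sub>F n in sequentially.
      of_nat k * (u (k * n) / of_nat (k * n)) = u (k * n) / of_nat n"
    using eventually_ge_at_top[of 1]
  proof eventually_elim
    case (elim n)
    show ?case
      using elim k
      by (cases "u (k * n)")
        (auto simp: ennreal_of_nat_eq_real_of_nat divide_ennreal ennreal_mult[symmetric]
          ennreal_top_divide ennreal_mult_top)
  qed
  ultimately show ?thesis by (simp add: tendsto_cong)
qed

section \<open>The order induced by a quasimetric\<close>

context Lqm
begin

text \<open>
  The semilattice axioms in metric form, with \<open>d y x = 0\<close> in place of \<open>x \<le> y\<close>.
\<close>

lemma dist_self: "x \<in> S \<Longrightarrow> d x x = 0"
  using QM1[of x x] by simp

lemma join_mem: "x \<in> S \<Longrightarrow> y \<in> S \<Longrightarrow> x \<squnion>\<^bsub>qm_order S d\<^esub> y \<in> S"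
  using join_closed[of x y] by (simp add: qm_order_def)

lemma dist_join_left: "x \<in> S \<Longrightarrow> y \<in> S \<Longrightarrow> d (x \<squnion>\<^bsub>qm_order S d\<^esub> y) x = 0"
  using join_left[of x y] by (simp add: qm_order_def)

lemma dist_join_right: "x \<in> S \<Longrightarrow> y \<in> S \<Longrightarrow> d (x \<squnion>\<^bsub>qm_order S d\<^esub> y) y = 0"
  using join_right[of x y] by (simp add: qm_order_def)

lemma dist_join_least:
  "x \<in> S \<Longrightarrow> y \<in> S \<Longrightarrow> z \<in> S \<Longrightarrow> d z x = 0 \<Longrightarrow> d z y = 0 \<Longrightarrow> d z (x \<squnion>\<^bsub>qm_order S d\<^esub> y) = 0"
  using join_le[of x z y] by (simp add: qm_order_def)

lemma bottom_mem: "\<bottom>\<^bsub>qm_order S d\<^esub> \<in> S"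
  using bottom_closed by (simp add: qm_order_def)

lemma dist_bottom: "x \<in> S \<Longrightarrow> d x \<bottom>\<^bsub>qm_order S d\<^esub> = 0"
  using bottom_lower[of x] by (simp add: qm_order_def)

lemma dist_mono_right:
  assumes "x \<in> S" "y \<in> S" "z \<in> S" "d z y = 0"
  shows "d x y \<le> d x z"
  using QM2[of x z y] assms by simp

lemma dist_antimono_left:
  assumes "x \<in> S" "y \<in> S" "z \<in> S" "d z x = 0"
  shows "d z y \<le> d x y"
  using QM2[of z x y] assms by simp

end

section \<open>Trajectories\<close>

text \<open>
  Stated for nonexpansive self-maps so that every lemma applies to \<open>\<phi>\<close> and to its powers alike.
\<close>

locale nonexpansive_Lqm = Lqm S d for S :: "'a set" and d :: "'a \<Rightarrow> 'a \<Rightarrow> ennreal" +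
  fixes \<phi> :: "'a \<Rightarrow> 'a"
  assumes map_mem: "x \<in> S \<Longrightarrow> \<phi> x \<in> S"
    and map_dist_le: "x \<in> S \<Longrightarrow> y \<in> S \<Longrightarrow> d (\<phi> x) (\<phi> y) \<le> d x y"
begin

lemma funpow_mem: "x \<in> S \<Longrightarrow> (\<phi> ^^ n) x \<in> S"
  by (induction n) (auto intro: map_mem)

lemma funpow_dist_le: "x \<in> S \<Longrightarrow> y \<in> S \<Longrightarrow> d ((\<phi> ^^ n) x) ((\<phi> ^^ n) y) \<le> d x y"
  by (induction n) (auto intro: order_trans map_dist_le funpow_mem)

lemma funpow_nonexpansive: "nonexpansive_Lqm S d (\<phi> ^^ n)"
  by unfold_locales (auto intro: funpow_mem funpow_dist_le)

text \<open>Zero distances stay zero, so nonexpansive maps are monotone.\<close>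

lemma funpow_mono:
  assumes "x \<in> S" "y \<in> S" "d y x = 0"
  shows "d ((\<phi> ^^ n) y) ((\<phi> ^^ n) x) = 0"
  using funpow_dist_le[of y x n] assms by simp

abbreviation T :: "'a \<Rightarrow> nat \<Rightarrow> 'a" where
  "T x n \<equiv> trajectory S d \<phi> x n"

lemma trajectory_mem: "x \<in> S \<Longrightarrow> T x n \<in> S"
  by (induction n) (auto intro: bottom_mem join_mem funpow_mem)

lemma trajectory_upper:
  assumes x: "x \<in> S" and "i < n"
  shows "d (T x n) ((\<phi> ^^ i) x) = 0"
  using \<open>i < n\<close>
proof (induction n)
  case (Suc n)
  note mem = trajectory_mem[OF x, of n] funpow_mem[OF x, of n]
  show ?case
  proof (cases "i = n")
    case True
    with mem show ?thesis by (simp add: dist_join_right)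
  next
    case False
    have "d (T x (Suc n)) ((\<phi> ^^ i) x) \<le> d (T x n) ((\<phi> ^^ i) x)"
      using mem dist_join_left[OF mem] funpow_mem[OF x]
      by (intro dist_antimono_left) (auto intro: join_mem)
    with False Suc show ?thesis by simp
  qed
qed simp

lemma trajectory_least:
  assumes "x \<in> S" "z \<in> S" "\<And>i. i < n \<Longrightarrow> d z ((\<phi> ^^ i) x) = 0"
  shows "d z (T x n) = 0"
  using assms(3)
  by (induction n) (auto intro!: dist_bottom dist_join_least trajectory_mem funpow_mem assms(1,2))

section \<open>Existence of the entropy limit\<close>

lemma trajectory_add_below_join:
  assumes x: "x \<in> S"
  shows "d (T x (Suc m) \<squnion>\<^bsub>qm_order S d\<^esub> (\<phi> ^^ m) (T x (Suc n))) (T x (Suc (m + n))) = 0"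
    (is "d ?J _ = 0")
proof (rule trajectory_least[OF x])
  let ?A = "T x (Suc m)" and ?B = "(\<phi> ^^ m) (T x (Suc n))"
  have A: "?A \<in> S" and B: "?B \<in> S"
    using x by (auto intro: trajectory_mem funpow_mem simp del: trajectory.simps)
  show J: "?J \<in> S" using A B by (rule join_mem)
  fix i assume i: "i < Suc (m + n)"
  have xi: "(\<phi> ^^ i) x \<in> S" using x by (rule funpow_mem)
  show "d ?J ((\<phi> ^^ i) x) = 0"
  proof (cases "i < Suc m")
    case True
    then have "d ?A ((\<phi> ^^ i) x) = 0" by (rule trajectory_upper[OF x])
    then show ?thesis
      using dist_antimono_left[OF A xi J dist_join_left[OF A B]] by simp
  next
    case False
    with i have "d (T x (Suc n)) ((\<phi> ^^ (i - m)) x) = 0"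
      by (intro trajectory_upper[OF x]) auto
    then have "d ?B ((\<phi> ^^ m) ((\<phi> ^^ (i - m)) x)) = 0"
      using x by (intro funpow_mono trajectory_mem funpow_mem)
    also have "(\<phi> ^^ m) ((\<phi> ^^ (i - m)) x) = (\<phi> ^^ i) x"
      using False by (simp flip: funpow_add[THEN fun_cong, unfolded comp_def])
    finally show ?thesis
      using dist_antimono_left[OF B xi J dist_join_right[OF A B]] by simp
  qed
qed

text \<open>
  After reaching \<open>T x (m + 1)\<close>, going on to \<open>T x (m + n + 1)\<close> costs at most the distance from
  \<open>T x (m + 1)\<close> to \<open>\<phi>\<^sup>m (T x (n + 1))\<close>.  As \<open>T x (m + 1)\<close> already contains \<open>\<phi>\<^sup>m x\<close>, this is at most
  the distance between the \<open>\<phi>\<^sup>m\<close>-images of \<open>x\<close> and \<open>T x (n + 1)\<close>.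
\<close>

lemma trajectory_dist_subadditive:
  assumes x: "x \<in> S"
  shows "d x (T x (Suc (m + n))) \<le> d x (T x (Suc m)) + d x (T x (Suc n))"
proof -
  let ?A = "T x (Suc m)" and ?B = "(\<phi> ^^ m) (T x (Suc n))"
  have mem: "T x i \<in> S" for i using x by (rule trajectory_mem)
  have B: "?B \<in> S" using mem by (rule funpow_mem)
  have xm: "(\<phi> ^^ m) x \<in> S" using x by (rule funpow_mem)
  have "d ?A (T x (Suc (m + n))) \<le> d ?A (?A \<squnion>\<^bsub>qm_order S d\<^esub> ?B)"
    by (intro dist_mono_right mem join_mem B trajectory_add_below_join[OF x])
  also have "\<dots> = d ?A ?B" by (rule QM3[OF mem B, symmetric])
  also have "\<dots> \<le> d ((\<phi> ^^ m) x) ?B"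
    by (intro dist_antimono_left mem B xm trajectory_upper[OF x]) simp
  also have "\<dots> \<le> d x (T x (Suc n))" by (intro funpow_dist_le x mem)
  finally have "d ?A (T x (Suc (m + n))) \<le> d x (T x (Suc n))" .
  then show ?thesis
    using QM2[OF x mem[of "Suc m"] mem[of "Suc (m + n)"]] by (meson add_left_mono order_trans)
qed

lemma trajectory_dist_finite:
  assumes "x \<in> inert_elements S d \<phi>"
  shows "d x (T x (Suc n)) < \<infinity>"
proof (induction n)
  have x: "x \<in> S" and fin: "d x (\<phi> x) < \<infinity>"
    using assms by (auto simp: inert_elements_def)
  case 0
  have "d x (T x (Suc 0)) = 0"
    by (rule trajectory_least[OF x x]) (simp add: dist_self x)
  then show ?case by simp
next
  have x: "x \<in> S" and fin: "d x (\<phi> x) < \<infinity>"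
    using assms by (auto simp: inert_elements_def)
  have J: "x \<squnion>\<^bsub>qm_order S d\<^esub> \<phi> x \<in> S" using x by (intro join_mem map_mem)
  case (Suc n)
  have "d (x \<squnion>\<^bsub>qm_order S d\<^esub> \<phi> x) (T x (Suc (Suc 0))) = 0"
    by (rule trajectory_least[OF x J])
      (auto simp: less_Suc_eq x map_mem dist_join_left dist_join_right)
  then have "d x (T x (Suc (Suc 0))) \<le> d x (x \<squnion>\<^bsub>qm_order S d\<^esub> \<phi> x)"
    using x J by (intro dist_mono_right trajectory_mem)
  also have "\<dots> = d x (\<phi> x)" using x by (intro QM3[symmetric] map_mem)
  finally have "d x (T x (Suc (n + 1))) \<le> d x (T x (Suc n)) + d x (\<phi> x)"
    using trajectory_dist_subadditive[OF x, of n 1] by (auto intro: order_trans add_left_mono simp del: trajectory.simps)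
  also have "\<dots> < \<infinity>" using Suc fin by simp
  finally show ?case by simp
qed

lemma entropy_at_tendsto:
  assumes inert: "x \<in> inert_elements S d \<phi>"
  shows "(\<lambda>n. d x (T x (Suc n)) / of_nat n) \<longlonglongrightarrow> qm_entropy_at S d \<phi> x"
    and "(\<lambda>n. d x (T x n) / of_nat n) \<longlonglongrightarrow> qm_entropy_at S d \<phi> x"
proof -
  define b where "b n = d x (T x (Suc n))" for n
  define L where "L = (INF n\<in>{1..}. b n / of_nat n)"
  have x: "x \<in> S" using inert by (simp add: inert_elements_def)
  have fin: "b n < \<infinity>" for n
    unfolding b_def using inert by (rule trajectory_dist_finite)
  have lim: "(\<lambda>n. b n / of_nat n) \<longlonglongrightarrow> L"
    unfolding L_def
    by (rule fekete_ennreal[OF _ fin]) (use trajectory_dist_subadditive[OF x] in \<open>simp add: b_def\<close>)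
  have "L \<le> b 1 / of_nat 1" unfolding L_def by (rule INF_lower) simp
  also have "\<dots> < \<infinity>"
    using fin[of 1] by (auto simp: less_top[symmetric] ennreal_divide_eq_top_iff)
  finally have "L < \<infinity>" .
  with lim fin have "(\<lambda>n. b n / of_nat (Suc n)) \<longlonglongrightarrow> L"
    by (rule tendsto_divide_of_nat_Suc_ennreal)
  then have lim': "(\<lambda>n. d x (T x n) / of_nat n) \<longlonglongrightarrow> L"
    unfolding b_def by (rule LIMSEQ_imp_Suc)
  then have "qm_entropy_at S d \<phi> x = L"
    unfolding qm_entropy_at_def by (rule limI)
  with lim lim' show "(\<lambda>n. d x (T x (Suc n)) / of_nat n) \<longlonglongrightarrow> qm_entropy_at S d \<phi> x"
    and "(\<lambda>n. d x (T x n) / of_nat n) \<longlonglongrightarrow> qm_entropy_at S d \<phi> x"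
    by (simp_all add: b_def)
qed

section \<open>Entropy of powers\<close>

lemma inert_elements_funpow:
  assumes "x \<in> inert_elements S d \<phi>"
  shows "x \<in> inert_elements S d (\<phi> ^^ k)"
proof -
  have x: "x \<in> S" using assms by (simp add: inert_elements_def)
  have "d x ((\<phi> ^^ k) x) \<le> d x (T x (Suc k))"
    using x by (intro dist_mono_right funpow_mem trajectory_mem trajectory_upper) auto
  also have "\<dots> < \<infinity>" using assms by (rule trajectory_dist_finite)
  finally show ?thesis using x by (simp add: inert_elements_def)
qed

lemma inert_elements_trajectory:
  assumes inert: "x \<in> inert_elements S d \<phi>" and n: "0 < n"
  shows "T x n \<in> inert_elements S d \<phi>"
proof -
  have x: "x \<in> S" and fin: "d x (\<phi> x) < \<infinity>"
    using inert by (auto simp: inert_elements_def)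
  have y: "T x n \<in> S" using x by (rule trajectory_mem)
  have "d x (T x n) < \<infinity>"
    using trajectory_dist_finite[OF inert, of "n - 1"] n by simp
  moreover have "d (T x n) (\<phi> (T x n)) \<le> d x (\<phi> (T x n))"
    using x y trajectory_upper[OF x n] by (intro dist_antimono_left map_mem) auto
  moreover have "d x (\<phi> (T x n)) \<le> d x (\<phi> x) + d (\<phi> x) (\<phi> (T x n))"
    using x y by (intro QM2 map_mem)
  moreover have "d (\<phi> x) (\<phi> (T x n)) \<le> d x (T x n)"
    using x y by (rule map_dist_le)
  ultimately have "d (T x n) (\<phi> (T x n)) \<le> d x (\<phi> x) + d x (T x n)"
    by (meson add_left_mono order_trans)
  also have "\<dots> < \<infinity>"
    using fin \<open>d x (T x n) < \<infinity>\<close> by simp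
  finally have "d (T x n) (\<phi> (T x n)) < \<infinity>" .
  then show ?thesis using y by (simp add: inert_elements_def)
qed

lemma trajectory_funpow_below:
  assumes x: "x \<in> S"
  shows "d (T x (Suc (k * n))) (trajectory S d (\<phi> ^^ k) x n) = 0"
proof -
  interpret pow: nonexpansive_Lqm S d "\<phi> ^^ k" by (rule funpow_nonexpansive)
  show ?thesis
  proof (rule pow.trajectory_least[OF x trajectory_mem[OF x]])
    fix i assume "i < n"
    then have "k * i < Suc (k * n)" by (simp add: less_Suc_eq_le)
    then show "d (T x (Suc (k * n))) (((\<phi> ^^ k) ^^ i) x) = 0"
      unfolding funpow_mult by (rule trajectory_upper[OF x])
  qed
qed

text \<open>
  Every \<open>j < k n\<close> is \<open>k q + r\<close> with \<open>q < n\<close> and \<open>r < k\<close>, and \<open>\<phi>\<^sup>r x\<close> is one of the points joined in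
  \<open>T x k\<close>; hence \<open>\<phi>\<^sup>j x\<close> lies below the \<open>q\<close>-th iterate of \<open>T x k\<close> under \<open>\<phi>\<^sup>k\<close>.
\<close>

lemma trajectory_below_funpow:
  assumes x: "x \<in> S"
  shows "d (trajectory S d (\<phi> ^^ k) (T x k) n) (T x (k * n)) = 0"
proof -
  interpret pow: nonexpansive_Lqm S d "\<phi> ^^ k" by (rule funpow_nonexpansive)
  let ?y = "T x k" and ?Y = "trajectory S d (\<phi> ^^ k) (T x k) n"
  have y: "?y \<in> S" using x by (rule trajectory_mem)
  have Y: "?Y \<in> S" using y by (rule pow.trajectory_mem)
  show ?thesis
  proof (rule trajectory_least[OF x Y])
    fix j assume j: "j < k * n"
    define q r where "q = j div k" and "r = j mod k"
    have "0 < k" using j by (cases k) auto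
    then have r: "r < k" and q: "q < n" and jqr: "j = q * k + r"
      using j by (auto simp: q_def r_def less_mult_imp_div_less mult.commute)
    have xr: "(\<phi> ^^ r) x \<in> S" using x by (rule funpow_mem)
    have "d (((\<phi> ^^ k) ^^ q) ?y) (((\<phi> ^^ k) ^^ q) ((\<phi> ^^ r) x)) = 0"
      using x y xr r by (intro pow.funpow_mono trajectory_upper)
    moreover have "((\<phi> ^^ k) ^^ q) ((\<phi> ^^ r) x) = (\<phi> ^^ j) x"
      unfolding jqr by (simp add: funpow_mult funpow_add mult.commute)
    moreover have "d ?Y (((\<phi> ^^ k) ^^ q) ?y) = 0"
      using y q by (rule pow.trajectory_upper)
    ultimately show "d ?Y ((\<phi> ^^ j) x) = 0"
      using dist_antimono_left[OF pow.funpow_mem[OF y, of q] funpow_mem[OF x, of j] Y] by simp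
  qed
qed

lemma entropy_at_funpow_le:
  assumes inert: "x \<in> inert_elements S d \<phi>"
  shows "qm_entropy_at S d (\<phi> ^^ k) x \<le> of_nat k * qm_entropy_at S d \<phi> x"
proof -
  interpret pow: nonexpansive_Lqm S d "\<phi> ^^ k" by (rule funpow_nonexpansive)
  have x: "x \<in> S" using inert by (simp add: inert_elements_def)
  have "(\<lambda>n. d x (T x (Suc (k * n))) / of_nat n) \<longlonglongrightarrow> of_nat k * qm_entropy_at S d \<phi> x"
  proof (cases "k = 0")
    case True
    have "d x (T x (Suc 0)) = 0"
      by (rule trajectory_least[OF x x]) (simp add: dist_self x)
    with True show ?thesis by (simp del: trajectory.simps)
  next
    case False
    then show ?thesis
      by (intro tendsto_subsequence_divide_of_nat_ennreal entropy_at_tendsto(1)[OF inert]) simp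
  qed
  moreover have "(\<lambda>n. d x (pow.T x n) / of_nat n) \<longlonglongrightarrow> qm_entropy_at S d (\<phi> ^^ k) x"
    by (intro pow.entropy_at_tendsto(2) inert_elements_funpow inert)
  moreover have "d x (pow.T x n) / of_nat n \<le> d x (T x (Suc (k * n))) / of_nat n" for n
    using x by (intro divide_right_mono_ennreal dist_mono_right trajectory_funpow_below
        trajectory_mem pow.trajectory_mem)
  ultimately show ?thesis by (blast intro: LIMSEQ_le)
qed

lemma entropy_at_funpow_trajectory_ge:
  assumes inert: "x \<in> inert_elements S d \<phi>" and k: "0 < k"
  shows "of_nat k * qm_entropy_at S d \<phi> x \<le> qm_entropy_at S d (\<phi> ^^ k) (T x k)"
proof -
  interpret pow: nonexpansive_Lqm S d "\<phi> ^^ k" by (rule funpow_nonexpansive)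
  let ?y = "T x k"
  have x: "x \<in> S" using inert by (simp add: inert_elements_def)
  then have y: "?y \<in> S" by (rule trajectory_mem)
  have inert_y: "?y \<in> inert_elements S d (\<phi> ^^ k)"
    using inert k by (intro inert_elements_funpow inert_elements_trajectory)
  have fin: "d x ?y < \<infinity>"
    using trajectory_dist_finite[OF inert, of "k - 1"] k by simp
  have "(\<lambda>n. d x (T x (k * n)) / of_nat n) \<longlonglongrightarrow> of_nat k * qm_entropy_at S d \<phi> x"
    by (intro tendsto_subsequence_divide_of_nat_ennreal entropy_at_tendsto(2)[OF inert] k)
  moreover have "(\<lambda>n. d x ?y / of_nat n + d ?y (pow.T ?y n) / of_nat n)
      \<longlonglongrightarrow> 0 + qm_entropy_at S d (\<phi> ^^ k) ?y"
    by (intro tendsto_add divide_of_nat_tendsto_0_ennreal fin pow.entropy_at_tendsto(2) inert_y)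
  moreover have "d x (T x (k * n)) / of_nat n
      \<le> d x ?y / of_nat n + d ?y (pow.T ?y n) / of_nat n" for n
  proof -
    have "d x (T x (k * n)) \<le> d x (pow.T ?y n)"
      using x y by (intro dist_mono_right trajectory_below_funpow trajectory_mem pow.trajectory_mem)
    also have "\<dots> \<le> d x ?y + d ?y (pow.T ?y n)"
      using x y by (intro QM2 pow.trajectory_mem)
    finally show ?thesis
      by (simp add: divide_right_mono_ennreal flip: add_divide_distrib_ennreal)
  qed
  ultimately have "of_nat k * qm_entropy_at S d \<phi> x \<le> 0 + qm_entropy_at S d (\<phi> ^^ k) ?y"
    by (blast intro: LIMSEQ_le)
  then show ?thesis by simp
qed

lemma entropy_funpow_ge: "of_nat k * qm_entropy S d \<phi> \<le> qm_entropy S d (\<phi> ^^ k)"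
proof (cases "k = 0")
  case False
  then have k: "0 < k" by simp
  show ?thesis
    unfolding qm_entropy_def SUP_mult_left_ennreal
  proof (rule SUP_mono)
    fix x assume x: "x \<in> inert_elements S d \<phi>"
    then have "T x k \<in> inert_elements S d (\<phi> ^^ k)"
      using k by (intro inert_elements_funpow inert_elements_trajectory)
    then show "\<exists>y\<in>inert_elements S d (\<phi> ^^ k).
        of_nat k * qm_entropy_at S d \<phi> x \<le> qm_entropy_at S d (\<phi> ^^ k) y"
      using entropy_at_funpow_trajectory_ge[OF x k] by blast
  qed
qed simp

text \<open>
  The inclusion carries real content: where \<open>d\<close> is infinite, \<open>\<phi>\<^sup>k\<close> may have inert points that are
  not inert for \<open>\<phi>\<close>, and these can make the entropy of \<open>\<phi>\<^sup>k\<close> strictly larger.  Take for \<open>S\<close> two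
  chains \<open>e\<^sub>0 < e\<^sub>1 < \<dots>\<close> and \<open>o\<^sub>0 < o\<^sub>1 < \<dots>\<close> between a bottom and a top, with
  \<open>d e\<^sub>i e\<^sub>j = d o\<^sub>i o\<^sub>j = j - i\<close> for \<open>i \<le> j\<close> and distance \<open>\<infinity>\<close> from \<open>x\<close> to \<open>y\<close> in all other cases
  without \<open>y \<le> x\<close>.  If \<open>\<phi>\<close> fixes bottom and top and maps \<open>e\<^sub>i\<close> to \<open>o\<^sub>i\<close> and \<open>o\<^sub>i\<close> to
  \<open>e\<^sub>i\<^sub>+\<^sub>1\<close>, only bottom and top are inert for \<open>\<phi>\<close>,
  which therefore has entropy \<open>0\<close>, while \<open>\<phi>\<^sup>2\<close> has entropy \<open>1\<close> at \<open>e\<^sub>0\<close>.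
\<close>

lemma entropy_funpow_le:
  assumes "inert_elements S d (\<phi> ^^ k) \<subseteq> inert_elements S d \<phi>"
  shows "qm_entropy S d (\<phi> ^^ k) \<le> of_nat k * qm_entropy S d \<phi>"
  unfolding qm_entropy_def SUP_mult_left_ennreal
  using assms by (intro SUP_mono) (blast intro: entropy_at_funpow_le)

end

theorem corollary4p10:
  fixes S :: "'a set" and d :: "'a \<Rightarrow> 'a \<Rightarrow> ennreal" and \<phi> :: "'a \<Rightarrow> 'a" and k :: nat
  assumes "Lqm_flow S d \<phi>"
    and "quasimetric S d"
  shows "qm_entropy S d (\<phi> ^^ k) = of_nat k * qm_entropy S d \<phi>"
proof -
  have Lqm: "Lqm S d" and mem: "\<phi> \<in> S \<rightarrow> S" and le: "\<forall>x\<in>S. \<forall>y\<in>S. d (\<phi> x) (\<phi> y) \<le> d x y"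
    using assms(1) by (auto simp: Lqm_flow_def Lqm_hom_def)
  interpret Lqm S d by (rule Lqm)
  interpret nonexpansive_Lqm S d \<phi> by unfold_locales (use mem le in auto)
  interpret quasimetric S d by (rule assms(2))
  have "inert_elements S d (\<phi> ^^ k) \<subseteq> inert_elements S d \<phi>"
    using finite_dist map_mem by (auto simp: inert_elements_def)
  then show ?thesis
    by (intro antisym entropy_funpow_le entropy_funpow_ge)
qed

end
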